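(* For every positive integer $r$ let $v_r=\lim_{n\to\infty}V_{n,r}$, where $V_{n,r}$ is the probability that a vertex chosen uniformly at random from the set of all vertices of all labeled non-plane 1-2 trees on vertex set $[n]$ is the root of a subtree of size exactly $r$ (these limits exist). Then \[\sum_{r=1}^\infty v_r=1.\]
   Context: A labeled non-plane 1-2 tree on vertex set $[n]=\{1,\dots,n\}$ is a rooted tree whose vertices are bijectively labeled by $[n]$, in which every vertex has at most two children, the label of each non-root vertex is less than the label of its parent, and the children of a vertex are unordered. The subtree of a vertex $v$ consists of $v$ and all its descendants; its size is its number of vertices. The random vertex is chosen uniformly among all pairs $(T,v)$ with $T$ such a tree on $[n]$ and $v$ a vertex of $T$. *)

theory Defs
  imports "HOL-Probability.Probability"
begin

text \<open>
  A rooted tree with vertex set \<open>V\<close> and root \<open>\<rho>\<close> is represented by the set \<open>E\<close> of its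
  edges, each edge being oriented as a pair (child, parent). In this way children are
  unordered, and distinct labeled trees correspond to distinct edge sets (the root is
  determined by \<open>V\<close> and \<open>E\<close>).
\<close>

definition rooted_tree :: "'a set \<Rightarrow> 'a \<Rightarrow> ('a \<times> 'a) set \<Rightarrow> bool" where
  "rooted_tree V \<rho> E \<longleftrightarrow>
     E \<subseteq> V \<times> V \<and> \<rho> \<in> V \<and>
     (\<forall>p. (\<rho>, p) \<notin> E) \<and>
     (\<forall>v \<in> V - {\<rho>}. \<exists>!p. (v, p) \<in> E) \<and>
     (\<forall>v \<in> V. (v, \<rho>) \<in> E\<^sup>*)"

definition children :: "('a \<times> 'a) set \<Rightarrow> 'a \<Rightarrow> 'a set" where
  "children E v = {c. (c, v) \<in> E}"

definition subtree :: "('a \<times> 'a) set \<Rightarrow> 'a \<Rightarrow> 'a set" where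
  "subtree E v = {u. (u, v) \<in> E\<^sup>*}"

definition trees12 :: "nat \<Rightarrow> (nat \<times> nat) set set" where
  "trees12 n =
     {E. (\<exists>\<rho>. rooted_tree {1..n} \<rho> E) \<and>
         (\<forall>v \<in> {1..n}. card (children E v) \<le> 2) \<and>
         (\<forall>(c, p) \<in> E. c < p)}"

definition tree_vertex_pairs :: "nat \<Rightarrow> ((nat \<times> nat) set \<times> nat) set" where
  "tree_vertex_pairs n = trees12 n \<times> {1..n}"

lemma finite_tree_vertex_pairs: "finite (tree_vertex_pairs n)"
proof -
  have "trees12 n \<subseteq> Pow ({1..n} \<times> {1..n})"
    by (auto simp: trees12_def rooted_tree_def)
  then have "finite (trees12 n)"
    by (rule finite_subset) auto
  then show ?thesis by (simp add: tree_vertex_pairs_def)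
qed

lemma tree_vertex_pairs_nonempty:
  assumes "n \<ge> 1"
  shows "tree_vertex_pairs n \<noteq> {}"
proof -
  define E where "E = {(i, Suc i) | i. 1 \<le> i \<and> i < n}"
  have reach: "(v, n) \<in> E\<^sup>*" if "1 \<le> v" "v \<le> n" for v
    using that(2,1)
  proof (induction v rule: inc_induct)
    case base
    then show ?case by simp
  next
    case (step v)
    then have "(v, Suc v) \<in> E" by (auto simp: E_def)
    moreover from step have "(Suc v, n) \<in> E\<^sup>*" by simp
    ultimately show ?case by (rule converse_rtrancl_into_rtrancl)
  qed
  have "rooted_tree {1..n} n E"
    unfolding rooted_tree_def using assms reach by (auto simp: E_def)
  moreover have "card (children E v) \<le> 2" for v
  proof -
    have "children E v \<subseteq> {v - 1}" by (auto simp: children_def E_def)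
    then have "card (children E v) \<le> card {v - 1}" by (rule card_mono[rotated]) simp
    then show ?thesis by simp
  qed
  moreover have "\<forall>(c, p) \<in> E. c < p" by (auto simp: E_def)
  ultimately have "E \<in> trees12 n" unfolding trees12_def by blast
  then show ?thesis using assms by (auto simp: tree_vertex_pairs_def)
qed

text \<open>
  By the two lemmas above, \<open>pmf_of_set\<close> is the uniform distribution for \<open>n \<ge> 1\<close>; the
  value at \<open>n = 0\<close> is meaningless and irrelevant to limits.
\<close>

definition V :: "nat \<Rightarrow> nat \<Rightarrow> real" where
  "V n r = measure_pmf.prob (pmf_of_set (tree_vertex_pairs n))
             {(E, v). card (subtree E v) = r}"

definition v_lim :: "nat \<Rightarrow> real" where
  "v_lim r = lim (\<lambda>n. V n r)"

end

theory Submission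
  imports Defs "HOL-Complex_Analysis.Complex_Analysis"
begin

text \<open>
  Let \<open>y\<close> and \<open>F\<^sub>r\<close> be the exponential generating functions of the trees (with an empty tree
  added) and of the pairs of a tree and a vertex whose subtree has size \<open>r\<close>. Removing the root, which
  carries the largest label, gives \<open>2y' = 1 + y\<^sup>2\<close> and \<open>F\<^sub>r' = y F\<^sub>r + c\<^sub>r z\<^sup>r\<^sup>-\<^sup>1\<close>, where \<open>c\<^sub>r\<close> is the
  coefficient of \<open>z\<^sup>r\<^sup>-\<^sup>1\<close> in \<open>y'\<close>. Hence \<open>y = sec + tan\<close>, \<open>y' = 1 / (1 - sin)\<close> and
  \<open>F\<^sub>r = y' G\<^sub>r\<close> with the entire function \<open>G\<^sub>r(z) = \<integral>\<^sub>0\<^sup>z (1 - sin t) c\<^sub>r t\<^sup>r\<^sup>-\<^sup>1 dt\<close>.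
  The probability \<open>V n r\<close> is the quotient of the \<open>n\<close>-th coefficients of \<open>F\<^sub>r\<close> and \<open>z y'\<close>.
  As \<open>y\<close> has a simple pole at \<open>\<pi>/2\<close> and no other singularity in \<open>\<bar>z\<bar> < 3\<pi>/2\<close>, consecutive
  coefficients of \<open>y'\<close> have ratio tending to \<open>\<pi>/2\<close>, so \<open>V n r\<close> tends to \<open>G\<^sub>r(\<pi>/2) / (\<pi>/2)\<close>. Summing
  over \<open>r\<close>, the integrands add up to \<open>(1 - sin t) y'(t) = 1\<close>.
\<close>

section \<open>Removing the root of a decreasing tree\<close>

text \<open>
  Decreasing 1-2 trees on a finite vertex set: since labels increase towards the root, the root
  is \<open>Max S\<close> and reachability of the root is automatic. For \<open>S = {}\<close> exactly one (empty) tree is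
  counted, which stands for a missing child.
\<close>

definition dtrees :: "'a::linorder set \<Rightarrow> ('a \<times> 'a) set set" where
  "dtrees S = {E. E \<subseteq> S \<times> S \<and> (\<forall>(c, p) \<in> E. c < p) \<and>
     (\<forall>v \<in> S - {Max S}. \<exists>!p. (v, p) \<in> E) \<and> (\<forall>v. card (children E v) \<le> 2)}"

lemma dtreesD:
  assumes "E \<in> dtrees S"
  shows "E \<subseteq> S \<times> S" "\<And>c p. (c, p) \<in> E \<Longrightarrow> c < p"
    "\<And>v. v \<in> S \<Longrightarrow> v \<noteq> Max S \<Longrightarrow> \<exists>!p. (v, p) \<in> E" "\<And>v. card (children E v) \<le> 2"
  using assms unfolding dtrees_def by auto

lemma finite_dtrees: "finite S \<Longrightarrow> finite (dtrees S)"
  by (rule finite_subset[of _ "Pow (S \<times> S)"]) (auto simp: dtrees_def)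

lemma dtrees_empty [simp]: "dtrees {} = {{}}"
  by (auto simp: dtrees_def children_def)

text \<open>The definition fixes a unique parent only for the other vertices; \<open>Max S\<close>
  has no parent at all, because a parent carries a larger label from \<open>S\<close>.\<close>

lemma dtrees_single_valued:
  assumes "finite S" "E \<in> dtrees S"
  shows "single_valued E"
proof (rule single_valuedI)
  fix x y z assume xy: "(x, y) \<in> E" and xz: "(x, z) \<in> E"
  have "x \<in> S" "y \<in> S" "x < y"
    using dtreesD(1,2)[OF assms(2)] xy by auto
  then have "x \<noteq> Max S" using Max_ge[OF assms(1), of y] by auto
  then show "y = z" using dtreesD(3)[OF assms(2) \<open>x \<in> S\<close>] xy xz by auto
qed

lemma rtrancl_increasing_le:
  fixes u v :: "'a::order"
  assumes "(u, v) \<in> E\<^sup>*" "\<And>c p. (c, p) \<in> E \<Longrightarrow> c < p"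
  shows "u \<le> v"
  using assms(1) by induction (use assms(2) in force)+

text \<open>The largest vertex failing to reach \<open>Max S\<close> would have a parent, which is
  larger and fails as well.\<close>

lemma increasing_reach_Max:
  fixes S :: "'a::linorder set"
  assumes fin: "finite S" and sub: "E \<subseteq> S \<times> S" and inc: "\<And>c p. (c, p) \<in> E \<Longrightarrow> c < p"
    and par: "\<And>v. v \<in> S \<Longrightarrow> v \<noteq> Max S \<Longrightarrow> \<exists>p. (v, p) \<in> E" and v: "v \<in> S"
  shows "(v, Max S) \<in> E\<^sup>*"
proof (rule ccontr)
  assume neg: "(v, Max S) \<notin> E\<^sup>*"
  define B where "B = {u \<in> S. (u, Max S) \<notin> E\<^sup>*}"
  have B: "finite B" "B \<noteq> {}" using fin v neg by (auto simp: B_def)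
  define u where "u = Max B"
  have u: "u \<in> B" unfolding u_def using B by (rule Max_in)
  then have "u \<in> S" "u \<noteq> Max S" by (auto simp: B_def)
  then obtain p where p: "(u, p) \<in> E" using par by blast
  then have "p \<in> B" using u sub by (auto simp: B_def intro: converse_rtrancl_into_rtrancl)
  then have "p \<le> u" using B unfolding u_def by simp
  then show False using inc[OF p] by simp
qed

lemma dtrees_reach_Max:
  assumes "finite S" "E \<in> dtrees S" "v \<in> S"
  shows "(v, Max S) \<in> E\<^sup>*"
  by (rule increasing_reach_Max[OF assms(1) dtreesD(1)[OF assms(2)]])
    (use dtreesD(2,3)[OF assms(2)] assms(3) in blast)+

lemma subtree_Max:
  assumes "finite S" "S \<noteq> {}" "E \<in> dtrees S"
  shows "subtree E (Max S) = S"
proof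
  show "S \<subseteq> subtree E (Max S)"
    using dtrees_reach_Max[OF assms(1,3)] by (auto simp: subtree_def)
  have "u \<in> S" if "(u, v) \<in> E\<^sup>*" "v \<in> S" for u v
    using that by (induction rule: converse_rtrancl_induct) (use dtreesD(1)[OF assms(3)] in auto)
  then show "subtree E (Max S) \<subseteq> S"
    using Max_in[OF assms(1,2)] by (auto simp: subtree_def)
qed

text \<open>If \<open>n\<close> were not the root, its parent would need a label above
  \<open>n\<close>; this identifies the root. At \<open>n = 0\<close> the two sets differ:
  \<open>dtrees {}\<close> contains the empty tree, while a rooted tree needs a root.\<close>

lemma trees12_eq_dtrees:
  assumes "n \<ge> 1"
  shows "trees12 n = dtrees {1..n}"
proof -
  have mx: "Max {1..n} = n" using assms by (intro Max_eqI) auto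
  show ?thesis
  proof (intro set_eqI iffI)
    fix E assume E: "E \<in> trees12 n"
    then obtain \<rho> where \<rho>: "rooted_tree {1..n} \<rho> E" by (auto simp: trees12_def)
    have inc: "\<And>c p. (c, p) \<in> E \<Longrightarrow> c < p" using E by (auto simp: trees12_def)
    have sub: "E \<subseteq> {1..n} \<times> {1..n}" using \<rho> by (simp add: rooted_tree_def)
    have "\<rho> = n"
    proof (rule ccontr)
      assume "\<rho> \<noteq> n"
      then have "n \<in> {1..n} - {\<rho>}" using assms by simp
      then obtain p where "(n, p) \<in> E" using \<rho> unfolding rooted_tree_def by blast
      then show False using inc sub by force
    qed
    moreover have "card (children E v) \<le> 2" for v
    proof (cases "v \<in> {1..n}")
      case True
      then show ?thesis using E by (auto simp: trees12_def)
    next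
      case False
      then have "children E v = {}" using sub by (auto simp: children_def)
      then show ?thesis by simp
    qed
    ultimately show "E \<in> dtrees {1..n}"
      using \<rho> inc sub unfolding dtrees_def mx rooted_tree_def by auto
  next
    fix E assume E: "E \<in> dtrees {1..n}"
    note d = dtreesD[OF E, unfolded mx]
    have "\<forall>p. (n, p) \<notin> E" using d(1,2) by force
    moreover have "\<forall>v\<in>{1..n}. (v, n) \<in> E\<^sup>*"
      using dtrees_reach_Max[OF _ E] mx by auto
    ultimately have "rooted_tree {1..n} n E"
      unfolding rooted_tree_def using d assms by auto
    then show "E \<in> trees12 n" unfolding trees12_def using d by auto
  qed
qed

section \<open>Joining two trees below a new root\<close>

definition graft :: "'a::linorder \<Rightarrow> 'a set \<Rightarrow> ('a \<times> 'a) set \<Rightarrow> ('a \<times> 'a) set" where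
  "graft m A E = (if A = {} then E else insert (Max A, m) E)"

text \<open>Either side may be empty, so that roots with no, one or two children are treated
  uniformly. One-sided facts are proved for \<open>A\<close> only; \<open>swap\<close> transfers
  them to \<open>B\<close>.\<close>

locale tree_join =
  fixes m :: "'a::linorder" and A B :: "'a set" and E1 E2 J :: "('a \<times> 'a) set"
  assumes fin: "finite A" "finite B" and disj: "A \<inter> B = {}"
    and E1: "E1 \<in> dtrees A" and E2: "E2 \<in> dtrees B"
    and less: "\<And>x. x \<in> A \<union> B \<Longrightarrow> x < m"
    and J: "J = graft m A E1 \<union> graft m B E2"
begin

lemma swap: "tree_join m B A E2 E1 J"
  using fin disj E1 E2 less J by unfold_locales auto

lemma edge_iff:
  "(c, p) \<in> J \<longleftrightarrow> (c, p) \<in> E1 \<or> (c, p) \<in> E2 \<or>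
     p = m \<and> (A \<noteq> {} \<and> c = Max A \<or> B \<noteq> {} \<and> c = Max B)"
  unfolding J graft_def by auto

lemma m_notin: "m \<notin> A" "m \<notin> B"
  using less by blast+

lemma edge_into: "p \<in> A \<Longrightarrow> (c, p) \<in> J \<longleftrightarrow> (c, p) \<in> E1"
  using edge_iff dtreesD(1)[OF E2] disj m_notin by blast

text \<open>Edges of \<open>J\<close> into \<open>A\<close> are edges of \<open>E1\<close>, so
  walking down from a vertex of \<open>A\<close> never leaves \<open>A\<close>.\<close>

lemma subtree_left:
  assumes "v \<in> A"
  shows "subtree J v = subtree E1 v"
proof -
  have "E1\<^sup>* \<subseteq> J\<^sup>*" by (rule rtrancl_mono) (auto simp: edge_iff)
  moreover have "(u, v) \<in> E1\<^sup>* \<and> u \<in> A" if "(u, v) \<in> J\<^sup>*" for u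
    using that
  proof (induction rule: converse_rtrancl_induct)
    case base
    then show ?case using assms by simp
  next
    case (step y z)
    then have "(y, z) \<in> E1" using edge_into by blast
    then show ?case using step dtreesD(1)[OF E1] by (auto intro: converse_rtrancl_into_rtrancl)
  qed
  ultimately show ?thesis by (auto simp: subtree_def)
qed

lemma Max_eq: "Max (insert m (A \<union> B)) = m"
  using fin less by (intro Max_eqI) (auto intro: less_imp_le)

lemma parent_left:
  assumes v: "v \<in> A"
  shows "\<exists>!p. (v, p) \<in> J"
proof (cases "v = Max A")
  case True
  have "(v, p) \<notin> E1" for p
  proof
    assume "(v, p) \<in> E1"
    then have "p \<in> A" "v < p" using dtreesD(1,2)[OF E1] by auto
    then show False using Max_ge[OF fin(1), of p] True by simp
  qed
  moreover have "(v, p) \<notin> E2" for p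
    using dtreesD(1)[OF E2] disj v by auto
  ultimately show ?thesis using True v by (auto simp: edge_iff)
next
  case False
  have "v \<notin> B" using v disj by auto
  then have "(v, p) \<in> J \<longleftrightarrow> (v, p) \<in> E1" for p
    using False Max_in[OF fin(2)] dtreesD(1)[OF E2] by (auto simp: edge_iff)
  then show ?thesis using dtreesD(3)[OF E1 v False] by simp
qed

lemma in_dtrees: "J \<in> dtrees (insert m (A \<union> B))"
proof -
  interpret s: tree_join m B A E2 E1 J by (rule swap)
  have "graft m A E1 \<subseteq> insert m A \<times> insert m A" "graft m B E2 \<subseteq> insert m B \<times> insert m B"
    using dtreesD(1)[OF E1] dtreesD(1)[OF E2] Max_in[OF fin(1)] Max_in[OF fin(2)]
    by (simp_all add: graft_def) blast+
  then have "J \<subseteq> insert m (A \<union> B) \<times> insert m (A \<union> B)"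
    unfolding J by blast
  moreover have "c < p" if "(c, p) \<in> J" for c p
    using that dtreesD(2)[OF E1] dtreesD(2)[OF E2] less[of "Max A"] less[of "Max B"]
      Max_in[OF fin(1)] Max_in[OF fin(2)]
    unfolding edge_iff by blast
  moreover have "card (children J v) \<le> 2" for v
  proof -
    consider "v \<in> A" | "v \<in> B" | "v = m" | "v \<notin> insert m (A \<union> B)" by blast
    then show ?thesis
    proof cases
      case 1
      then have "children J v = children E1 v" by (simp add: children_def edge_into)
      then show ?thesis using dtreesD(4)[OF E1] by simp
    next
      case 2
      then have "children J v = children E2 v" by (simp add: children_def s.edge_into)
      then show ?thesis using dtreesD(4)[OF E2] by simp
    next
      case 3
      then have "children J v \<subseteq> {Max A, Max B}"
        using dtreesD(1)[OF E1] dtreesD(1)[OF E2] m_notin by (auto simp: children_def edge_iff)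
      then have "card (children J v) \<le> card {Max A, Max B}" by (rule card_mono[rotated]) simp
      also have "\<dots> \<le> 2" by (simp add: card_insert_if)
      finally show ?thesis .
    next
      case 4
      then have "children J v = {}"
        using \<open>J \<subseteq> _\<close> by (auto simp: children_def)
      then show ?thesis by simp
    qed
  qed
  moreover have "\<forall>v \<in> insert m (A \<union> B) - {m}. \<exists>!p. (v, p) \<in> J"
    using parent_left s.parent_left by blast
  ultimately show ?thesis
    unfolding dtrees_def Max_eq by auto
qed

lemma subtree_root: "subtree J m = insert m (A \<union> B)"
  using subtree_Max[OF _ _ in_dtrees] fin by (simp add: Max_eq del: Max_insert)

text \<open>Together with \<open>subtree_Max_left\<close> this recovers the two branches from
  \<open>J\<close> once the children of \<open>m\<close> are known, which gives injectivity
  below.\<close>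

lemma restrict_left: "J \<inter> A \<times> A = E1"
  using edge_into dtreesD(1)[OF E1] by auto

lemma child_left: "A \<noteq> {} \<Longrightarrow> (Max A, m) \<in> J"
  by (simp add: edge_iff)

lemma subtree_Max_left: "A \<noteq> {} \<Longrightarrow> subtree J (Max A) = A"
  using subtree_left[of "Max A"] subtree_Max[OF fin(1) _ E1] fin by simp

lemma child_root: "(c, m) \<in> J \<longleftrightarrow> A \<noteq> {} \<and> c = Max A \<or> B \<noteq> {} \<and> c = Max B"
  using dtreesD(1)[OF E1] dtreesD(1)[OF E2] m_notin by (auto simp: edge_iff)

end

text \<open>A path to \<open>c\<close> from another vertex \<open>v\<close> of the subtree starts
  with the edge to the unique parent of \<open>v\<close>, so this parent lies in the subtree
  too.\<close>

lemma dtrees_restrict_subtree: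
  fixes S :: "'a::linorder set"
  assumes fin: "finite S" and E: "E \<in> dtrees S" and c: "c \<in> S"
  defines "A \<equiv> subtree E c"
  shows "A \<subseteq> S" "Max A = c" "E \<inter> A \<times> A \<in> dtrees A"
proof -
  note d = dtreesD[OF E]
  show AS: "A \<subseteq> S"
  proof
    fix u assume "u \<in> A"
    then have "(u, c) \<in> E\<^sup>*" by (simp add: A_def subtree_def)
    then show "u \<in> S" by (cases rule: converse_rtranclE) (use c d(1) in auto)
  qed
  have le: "u \<le> c" if "u \<in> A" for u
    using that rtrancl_increasing_le[OF _ d(2)] by (auto simp: A_def subtree_def)
  have cA: "c \<in> A" by (simp add: A_def subtree_def)
  show mx: "Max A = c"
    using finite_subset[OF AS fin] le cA by (intro Max_eqI) auto
  have sv: "single_valued E" by (rule dtrees_single_valued[OF fin E])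
  have "\<exists>!p. (v, p) \<in> E \<inter> A \<times> A" if v: "v \<in> A" "v \<noteq> c" for v
  proof -
    have "(v, c) \<in> E\<^sup>*" using v by (simp add: A_def subtree_def)
    then obtain p where "(v, p) \<in> E" "(p, c) \<in> E\<^sup>*"
      using v(2) by (cases rule: converse_rtranclE) auto
    then show ?thesis using v sv by (auto simp: A_def subtree_def single_valued_def)
  qed
  moreover have "card (children (E \<inter> A \<times> A) v) \<le> 2" for v
  proof -
    have "children E v \<subseteq> S" using d(1) by (auto simp: children_def)
    then have "finite (children E v)" using fin finite_subset by blast
    then have "card (children (E \<inter> A \<times> A) v) \<le> card (children E v)"
      by (rule card_mono) (auto simp: children_def)
    then show ?thesis using d(4)[of v] by simp
  qed
  ultimately show "E \<inter> A \<times> A \<in> dtrees A"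
    unfolding dtrees_def mx using d(2) by auto
qed

text \<open>
  Removing the root leaves an unordered pair of possibly empty trees; requiring \<open>s \<in> A\<close> orders it.
\<close>

definition splittings :: "'a::linorder set \<Rightarrow> 'a \<Rightarrow> ('a set \<times> ('a \<times> 'a) set \<times> ('a \<times> 'a) set) set"
  where "splittings S s = (SIGMA A : {A. A \<subseteq> S \<and> s \<in> A}. dtrees A \<times> dtrees (S - A))"

text \<open>The inverse takes for \<open>A\<close> the subtree of that child of \<open>m\<close>
  which has \<open>s\<close> in its subtree; what remains is the subtree of the other child, or
  empty.\<close>

lemma dtrees_bij_splittings:
  fixes m :: "'a::linorder"
  assumes fin: "finite S" and less: "\<And>x. x \<in> S \<Longrightarrow> x < m" and s: "s \<in> S"
  shows "bij_betw (\<lambda>(A, E1, E2). graft m A E1 \<union> graft m (S - A) E2)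
           (splittings S s) (dtrees (insert m S))"
    (is "bij_betw ?f _ _")
proof (rule bij_betw_imageI)
  have tj: "tree_join m A (S - A) E1 E2 (?f (A, E1, E2))" if "(A, E1, E2) \<in> splittings S s" for A E1 E2
    using that fin less by unfold_locales (auto simp: splittings_def intro: finite_subset)
  show "inj_on ?f (splittings S s)"
  proof (rule inj_onI)
    fix x y assume x: "x \<in> splittings S s" and y: "y \<in> splittings S s" and eq: "?f x = ?f y"
    obtain A E1 E2 where x': "x = (A, E1, E2)" by (cases x)
    obtain A' E1' E2' where y': "y = (A', E1', E2')" by (cases y)
    interpret X: tree_join m A "S - A" E1 E2 "?f x" using tj x x' by simp
    interpret Y: tree_join m A' "S - A'" E1' E2' "?f x" using tj y y' eq by simp
    interpret X': tree_join m "S - A" A E2 E1 "?f x" by (rule X.swap)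
    interpret Y': tree_join m "S - A'" A' E2' E1' "?f x" by (rule Y.swap)
    have s': "s \<in> A" "s \<in> A'" "A \<subseteq> S" "A' \<subseteq> S"
      using x y by (auto simp: x' y' splittings_def)
    \<comment> \<open>The root of \<open>A'\<close> is a child of \<open>m\<close> in the common
      tree, hence the root of \<open>A\<close> or of \<open>S - A\<close>. The second case would
      give \<open>A' = S - A\<close>, although \<open>s\<close> lies in both \<open>A\<close> and
      \<open>A'\<close>.\<close>
    have "(Max A', m) \<in> ?f x" using Y.child_left s' by blast
    then consider "Max A' = Max A" | "S - A \<noteq> {}" "Max A' = Max (S - A)"
      unfolding X.child_root by blast
    then have AA: "A = A'"
    proof cases
      case 1
      then show ?thesis using X.subtree_Max_left Y.subtree_Max_left s' by auto
    next
      case 2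
      then have "A' = S - A" using X'.subtree_Max_left Y.subtree_Max_left s' by auto
      then show ?thesis using s' by auto
    qed
    then show "x = y"
      using X.restrict_left Y.restrict_left X'.restrict_left Y'.restrict_left by (simp add: x' y')
  qed
  show "?f ` splittings S s = dtrees (insert m S)"
  proof (intro subset_antisym subsetI)
    fix J assume "J \<in> ?f ` splittings S s"
    then obtain A E1 E2 where x: "(A, E1, E2) \<in> splittings S s" and J: "J = ?f (A, E1, E2)" by auto
    interpret X: tree_join m A "S - A" E1 E2 J using tj x J by simp
    have "A \<union> (S - A) = S" using x by (auto simp: splittings_def)
    then show "J \<in> dtrees (insert m S)" using X.in_dtrees by simp
  next
    fix E assume E: "E \<in> dtrees (insert m S)"
    have fin': "finite (insert m S)" using fin by simp
    have mx: "Max (insert m S) = m"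
      using fin less by (intro Max_eqI) (auto intro: less_imp_le)
    note d = dtreesD[OF E, unfolded mx]
    note reach = dtrees_reach_Max[OF fin' E, unfolded mx]
    have sv: "single_valued E" by (rule dtrees_single_valued[OF fin' E])
    have child: "\<exists>c. (c, m) \<in> E \<and> u \<in> subtree E c \<and> c \<in> S" if "u \<in> S" for u
    proof -
      have "(u, m) \<in> E\<^sup>*" "u \<noteq> m" using reach that less by auto
      then obtain c where "(u, c) \<in> E\<^sup>*" "(c, m) \<in> E" by (auto elim: rtranclE)
      then show ?thesis using d(1,2) by (force simp: subtree_def)
    qed
    have sub_in: "subtree E c \<subseteq> S" if "(c, m) \<in> E" for c
    proof
      fix u assume u: "u \<in> subtree E c"
      then have "u \<le> c" using rtrancl_increasing_le[OF _ d(2)] by (auto simp: subtree_def)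
      then have "u \<noteq> m" using d(2)[OF that] by auto
      then show "u \<in> S" using u dtrees_restrict_subtree(1)[OF fin' E, of c] d(1) that by auto
    qed
    obtain c where c: "(c, m) \<in> E" "s \<in> subtree E c" "c \<in> S" using child s by blast
    define A where "A = subtree E c"
    define B where "B = S - A"
    note rA = dtrees_restrict_subtree[OF fin' E, of c, folded A_def]
    have AS: "A \<subseteq> S" using sub_in c unfolding A_def by blast
    \<comment> \<open>What lies outside \<open>A\<close> is a tree whose root, if any, is the only
      further child of \<open>m\<close>. The bound of two children enters here.\<close>
    have B: "E \<inter> B \<times> B \<in> dtrees B \<and> (\<forall>c'. (c', m) \<in> E \<longrightarrow> c' = c \<or> B \<noteq> {} \<and> c' = Max B) \<and>
       (B \<noteq> {} \<longrightarrow> (Max B, m) \<in> E)"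
    proof (cases "\<exists>c'. (c', m) \<in> E \<and> c' \<noteq> c")
      case False
      then have "B = {}" using child unfolding B_def A_def by blast
      then show ?thesis using False by (auto simp del: Int_iff)
    next
      case True
      then obtain c' where c': "(c', m) \<in> E" "c' \<noteq> c" by blast
      have fc: "finite (children E m)"
        by (rule finite_subset[OF _ fin']) (use d(1) in \<open>auto simp: children_def\<close>)
      have ch: "x = c \<or> x = c'" if "(x, m) \<in> E" for x
      proof (rule ccontr)
        assume "\<not> (x = c \<or> x = c')"
        then have "card {x, c, c'} = 3" using c' by auto
        moreover have "card {x, c, c'} \<le> card (children E m)"
          by (rule card_mono[OF fc]) (use that c c' in \<open>auto simp: children_def\<close>)
        ultimately show False using d(4)[of m] by simp
      qed
      \<comment> \<open>A path leaving \<open>x\<close> passes through its only parent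
        \<open>m\<close>, and labels increase along paths, so it cannot end in
        \<open>y < m\<close>.\<close>
      have no_path: False if xy: "(x, m) \<in> E" "(y, m) \<in> E" "x \<noteq> y" "(x, y) \<in> E\<^sup>*" for x y
      proof -
        obtain z where "(x, z) \<in> E" "(z, y) \<in> E\<^sup>*"
          using xy(3,4) by (auto elim: converse_rtranclE)
        then have "(m, y) \<in> E\<^sup>*" using sv xy(1) by (auto simp: single_valued_def)
        then have "m \<le> y" using rtrancl_increasing_le[OF _ d(2)] by blast
        then show False using d(2)[OF xy(2)] by simp
      qed
      \<comment> \<open>Under a single-valued relation any two vertices reachable from the same
        \<open>u\<close> are comparable, which \<open>no_path\<close> excludes for two children of
        \<open>m\<close>.\<close>
      have "subtree E c \<inter> subtree E c' = {}"
      proof (rule ccontr)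
        assume "subtree E c \<inter> subtree E c' \<noteq> {}"
        then obtain u where "(u, c) \<in> E\<^sup>*" "(u, c') \<in> E\<^sup>*" by (auto simp: subtree_def)
        then have "(c, c') \<in> E\<^sup>* \<or> (c', c) \<in> E\<^sup>*" by (rule single_valued_confluent[OF sv])
        then show False using no_path c c' by blast
      qed
      then have BB: "B = subtree E c'"
        using child ch sub_in[OF c'(1)] unfolding B_def A_def by blast
      have "c' \<in> insert m S" using d(1) c' by auto
      note rB = dtrees_restrict_subtree[OF fin' E this, folded BB]
      have "B \<noteq> {}" unfolding BB subtree_def by auto
      then show ?thesis using rB ch c' by auto
    qed
    \<comment> \<open>By \<open>into\<close> and \<open>out\<close> only edges to \<open>m\<close>
      can cross the border of \<open>A\<close>; all others stay inside \<open>A\<close> or inside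
      \<open>B\<close>.\<close>
    have into: "q \<in> A" if "(q, p) \<in> E" "p \<in> A" for p q
      using that by (auto simp: A_def subtree_def intro: converse_rtrancl_into_rtrancl)
    have out: "p \<in> A \<or> p = m" if qp: "(q, p) \<in> E" "q \<in> A" for p q
    proof (cases "q = c")
      case True
      then show ?thesis using sv c(1) qp by (auto simp: single_valued_def)
    next
      case False
      then obtain z where "(q, z) \<in> E" "(z, c) \<in> E\<^sup>*"
        using qp(2) by (auto simp: A_def subtree_def elim: converse_rtranclE)
      then show ?thesis using sv qp(1) by (auto simp: A_def subtree_def single_valued_def)
    qed
    have A: "A \<noteq> {}" "Max A = c" "s \<in> A"
      using c rA(2) by (auto simp: A_def)
    have "E = graft m A (E \<inter> A \<times> A) \<union> graft m B (E \<inter> B \<times> B)" (is "_ = ?R")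
    proof (intro subset_antisym subsetI)
      fix e assume e: "e \<in> E"
      obtain q p where qp: "e = (q, p)" by (cases e)
      show "e \<in> ?R"
      proof (cases "p = m")
        case True
        then show ?thesis using B e A by (auto simp: graft_def qp)
      next
        case False
        have "q < p" using d(2) e qp by auto
        moreover have "p \<in> S" "q \<in> insert m S" using d(1) e qp False by auto
        ultimately have "q \<in> S" using less[of p] by auto
        then have "q \<in> A \<and> p \<in> A \<or> q \<in> B \<and> p \<in> B"
          using into out e qp False \<open>p \<in> S\<close> unfolding B_def by blast
        then show ?thesis using e by (auto simp: qp graft_def)
      qed
    next
      fix e assume "e \<in> ?R"
      then have "e \<in> E \<or> e = (c, m) \<or> B \<noteq> {} \<and> e = (Max B, m)"
        using A by (cases "B = {}") (auto simp: graft_def)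
      then show "e \<in> E" using B c by blast
    qed
    moreover have "(A, E \<inter> A \<times> A, E \<inter> B \<times> B) \<in> splittings S s"
      using A AS B rA c by (auto simp: splittings_def B_def)
    ultimately show "E \<in> ?f ` splittings S s"
      unfolding B_def by force
  qed
qed

section \<open>Counting\<close>

text \<open>Complementation exchanges the subsets containing \<open>s\<close> with those avoiding
  it. This turns sums over \<open>splittings\<close> into sums over all subsets, as products of
  generating functions require.\<close>

lemma sum_Pow_halve:
  fixes h :: "'a set \<Rightarrow> 'a set \<Rightarrow> 'b::comm_monoid_add"
  assumes fin: "finite S" and s: "s \<in> S"
  shows "(\<Sum>A\<in>Pow S. h A (S - A)) = (\<Sum>A | A \<subseteq> S \<and> s \<in> A. h A (S - A) + h (S - A) A)"
proof -
  have "(\<Sum>A\<in>Pow S. h A (S - A)) =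
      (\<Sum>A | A \<subseteq> S \<and> s \<in> A. h A (S - A)) + (\<Sum>A | A \<subseteq> S \<and> s \<notin> A. h A (S - A))"
    using fin by (subst sum.union_disjoint[symmetric]) (auto intro!: sum.cong)
  also have "(\<Sum>A | A \<subseteq> S \<and> s \<notin> A. h A (S - A)) = (\<Sum>A | A \<subseteq> S \<and> s \<in> A. h (S - A) A)"
    by (rule sum.reindex_bij_witness[of _ "\<lambda>A. S - A" "\<lambda>A. S - A"])
      (use s in \<open>auto simp: double_diff\<close>)
  finally show ?thesis by (simp add: sum.distrib)
qed

lemma sum_Pow_card:
  fixes f :: "nat \<Rightarrow> 'b::semiring_1"
  assumes "finite S"
  shows "(\<Sum>A\<in>Pow S. f (card A)) = (\<Sum>k\<le>card S. of_nat (card S choose k) * f k)"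
proof -
  have "(\<Sum>A\<in>Pow S. f (card A)) = (\<Sum>k\<le>card S. \<Sum>A\<in>{A \<in> Pow S. card A = k}. f (card A))"
    using assms by (intro sum.group[symmetric]) (auto intro: card_mono)
  also have "\<dots> = (\<Sum>k\<le>card S. of_nat (card {A. A \<subseteq> S \<and> card A = k}) * f k)"
    by (intro sum.cong) simp_all
  finally show ?thesis using n_subsets[OF assms] by simp
qed

section \<open>Counting pairs of a tree and a vertex\<close>

definition hits :: "nat \<Rightarrow> 'a set \<Rightarrow> ('a \<times> 'a) set \<Rightarrow> nat" where
  "hits r S E = card {v \<in> S. card (subtree E v) = r}"

definition total_hits :: "nat \<Rightarrow> 'a::linorder set \<Rightarrow> nat" where
  "total_hits r S = (\<Sum>E\<in>dtrees S. hits r S E)"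

lemma dtrees_singleton: "dtrees {m} = {{}}"
proof -
  have "E = {}" if "E \<in> dtrees {m}" for E
    using dtreesD(1,2)[OF that] by fastforce
  then show ?thesis by (auto simp: dtrees_def children_def)
qed

lemma subtree_empty: "subtree {} v = {v}"
  by (auto simp: subtree_def)

text \<open>Joining leaves the subtrees of all vertices below \<open>m\<close> unchanged, while the
  subtree of \<open>m\<close> is the whole tree.\<close>

lemma (in tree_join) hits_join:
  "hits r (insert m (A \<union> B)) J =
     hits r A E1 + hits r B E2 + (if card A + card B + 1 = r then 1 else 0)"
proof -
  interpret s: tree_join m B A E2 E1 J by (rule swap)
  have "{v \<in> insert m (A \<union> B). card (subtree J v) = r} =
      ({v \<in> A. card (subtree E1 v) = r} \<union> {v \<in> B. card (subtree E2 v) = r}) \<union>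
      {v \<in> {m}. card (insert m (A \<union> B)) = r}"
    by (auto simp: subtree_left s.subtree_left subtree_root)
  moreover have "card (insert m (A \<union> B)) = card A + card B + 1"
    using fin disj m_notin by (simp add: card_Un_disjoint)
  moreover have "card ({v \<in> A. card (subtree E1 v) = r} \<union> {v \<in> B. card (subtree E2 v) = r} \<union>
      {v \<in> {m}. card A + card B + 1 = r}) = hits r A E1 + hits r B E2 +
      card {v \<in> {m}. card A + card B + 1 = r}"
    unfolding hits_def using fin disj m_notin
    by (subst card_Un_disjoint, simp, simp, blast, subst card_Un_disjoint) auto
  ultimately show ?thesis by (simp add: hits_def)
qed

lemma finite_splittings_index: "finite S \<Longrightarrow> finite {A. A \<subseteq> S \<and> s \<in> A}"
  by (rule finite_subset[of _ "Pow S"]) auto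

lemma sum_splittings:
  assumes "finite S"
  shows "(\<Sum>x\<in>splittings S s. f x) =
    (\<Sum>A | A \<subseteq> S \<and> s \<in> A. \<Sum>E1\<in>dtrees A. \<Sum>E2\<in>dtrees (S - A). f (A, E1, E2))"
proof -
  have "finite (dtrees A)" if "A \<subseteq> S" for A
    using finite_dtrees finite_subset[OF that assms] by blast
  then have "(\<Sum>A | A \<subseteq> S \<and> s \<in> A. \<Sum>p\<in>dtrees A \<times> dtrees (S - A). f (A, p)) =
      (\<Sum>(A, p)\<in>splittings S s. f (A, p))"
    unfolding splittings_def using finite_splittings_index[OF assms]
    by (intro sum.Sigma) auto
  then show ?thesis by (simp add: sum.cartesian_product case_prod_unfold)
qed

text \<open>Summing over all subsets counts every tree twice, once for each order of its two
  branches. With \<open>S = {}\<close> there is just one order, and the equation would read 2 =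
  1.\<close>

lemma card_dtrees_insert:
  fixes m :: "'a::linorder"
  assumes fin: "finite S" and less: "\<And>x. x \<in> S \<Longrightarrow> x < m" and ne: "S \<noteq> {}"
  shows "2 * card (dtrees (insert m S)) = (\<Sum>A\<in>Pow S. card (dtrees A) * card (dtrees (S - A)))"
proof -
  obtain s where s: "s \<in> S" using ne by blast
  have "card (dtrees (insert m S)) = (\<Sum>x\<in>splittings S s. 1)"
    using bij_betw_same_card[OF dtrees_bij_splittings[OF fin less s]] by simp
  also have "\<dots> = (\<Sum>A | A \<subseteq> S \<and> s \<in> A. card (dtrees A) * card (dtrees (S - A)))"
    unfolding sum_splittings[OF fin] by simp
  finally show ?thesis
    unfolding sum_Pow_halve[OF fin s, of "\<lambda>A B. card (dtrees A) * card (dtrees B)"]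
    by (simp add: sum_distrib_left mult.commute mult_2)
qed

text \<open>No factor 2 arises here: a chosen vertex other than the root singles out its branch
  \<open>A\<close>. For \<open>S = {}\<close> the sum vanishes, since the empty tree has no vertex
  to choose.\<close>

lemma total_hits_insert:
  fixes m :: "'a::linorder"
  assumes fin: "finite S" and less: "\<And>x. x \<in> S \<Longrightarrow> x < m"
  shows "total_hits r (insert m S) = (\<Sum>A\<in>Pow S. total_hits r A * card (dtrees (S - A))) +
           (if card S + 1 = r then card (dtrees (insert m S)) else 0)"
proof (cases "S = {}")
  case True
  then show ?thesis
    by (simp add: total_hits_def dtrees_singleton hits_def subtree_empty)
next
  case False
  then obtain s where s: "s \<in> S" by blast
  let ?c = "if card S + 1 = r then 1 else 0 :: nat"
  let ?f = "\<lambda>(A, E1, E2). graft m A E1 \<union> graft m (S - A) E2"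
  note bij = dtrees_bij_splittings[OF fin less s]
  have "total_hits r (insert m S) = (\<Sum>x\<in>splittings S s. hits r (insert m S) (?f x))"
    unfolding total_hits_def by (rule sum.reindex_bij_betw[OF bij, symmetric])
  also have "\<dots> = (\<Sum>x\<in>splittings S s.
      (case x of (A, E1, E2) \<Rightarrow> hits r A E1 + hits r (S - A) E2) + ?c)"
  proof (rule sum.cong[OF refl])
    fix x assume x: "x \<in> splittings S s"
    obtain A E1 E2 where x': "x = (A, E1, E2)" by (cases x)
    have A: "A \<subseteq> S" using x by (auto simp: x' splittings_def)
    have "tree_join m A (S - A) E1 E2 (?f x)"
      using x fin less by unfold_locales (auto simp: x' splittings_def intro: finite_subset)
    note h = tree_join.hits_join[OF this, of r]
    have "card A + card (S - A) = card S"
      using A fin by (simp add: card_Diff_subset finite_subset card_mono)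
    moreover have "A \<union> (S - A) = S" using A by blast
    ultimately show "hits r (insert m S) (?f x) =
        (case x of (A, E1, E2) \<Rightarrow> hits r A E1 + hits r (S - A) E2) + ?c"
      using h by (simp add: x')
  qed
  also have "\<dots> = (\<Sum>x\<in>splittings S s. case x of (A, E1, E2) \<Rightarrow> hits r A E1 + hits r (S - A) E2)
      + card (splittings S s) * ?c"
    by (simp only: sum.distrib sum_constant of_nat_id)
  also have "card (splittings S s) = card (dtrees (insert m S))"
    by (rule bij_betw_same_card[OF bij])
  also have "(\<Sum>x\<in>splittings S s. case x of (A, E1, E2) \<Rightarrow> hits r A E1 + hits r (S - A) E2) =
      (\<Sum>A | A \<subseteq> S \<and> s \<in> A. total_hits r A * card (dtrees (S - A)) +
         total_hits r (S - A) * card (dtrees A))"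
    unfolding sum_splittings[OF fin]
    by (simp add: sum.distrib total_hits_def sum_distrib_left mult.commute)
  also have "\<dots> = (\<Sum>A\<in>Pow S. total_hits r A * card (dtrees (S - A)))"
    by (rule sum_Pow_halve[OF fin s, of "\<lambda>A B. total_hits r A * card (dtrees B)", symmetric])
  finally show ?thesis by simp
qed

text \<open>The Euler zigzag numbers 1, 1, 1, 2, 5, 16, ...; index 0 counts the empty tree.\<close>

definition zigzag :: "nat \<Rightarrow> nat" where
  "zigzag n = card (dtrees {1..n})"

definition num_hits :: "nat \<Rightarrow> nat \<Rightarrow> nat" where
  "num_hits r n = total_hits r {1..n}"

section \<open>The counts depend only on the number of labels\<close>

lemma insert_Max_split:
  fixes S :: "'a::linorder set"
  assumes "finite S" "card S = Suc k"
  obtains m S0 where "S = insert m S0" "finite S0" "card S0 = k" "\<And>x. x \<in> S0 \<Longrightarrow> x < m"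
proof
  have ne: "S \<noteq> {}" using assms by auto
  show "S = insert (Max S) (S - {Max S})" using Max_in[OF assms(1) ne] by blast
  show "finite (S - {Max S})" using assms by simp
  show "card (S - {Max S}) = k" using assms Max_in[OF assms(1) ne] by simp
  show "x < Max S" if "x \<in> S - {Max S}" for x
    using that Max_ge[OF assms(1), of x] by (simp add: order.strict_iff_order)
qed

text \<open>Instead of relabeling trees, a strong induction shows that \<open>S\<close> and
  \<open>{1..card S}\<close> obey the same recurrence, whose right-hand side depends on
  cardinalities only. Singletons are separate because \<open>card_dtrees_insert\<close> asks for a
  nonempty set.\<close>

lemma card_dtrees_eq_zigzag:
  fixes S :: "nat set"
  assumes "finite S"
  shows "card (dtrees S) = zigzag (card S)"
  using assms
proof (induction "card S" arbitrary: S rule: less_induct)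
  case less
  show ?case
  proof (cases "card S")
    case 0
    then show ?thesis using less.prems by (simp add: zigzag_def)
  next
    case (Suc k)
    show ?thesis
    proof (cases "k = 0")
      case True
      then obtain x where "S = {x}" using Suc card_1_singletonE by auto
      then show ?thesis by (simp add: zigzag_def dtrees_singleton)
    next
      case False
      have rec: "2 * card (dtrees T) = (\<Sum>j\<le>k. of_nat (k choose j) * (zigzag j * zigzag (k - j)))"
        if T: "finite T" "card T = Suc k" for T :: "nat set"
      proof -
        obtain m T0 where m: "T = insert m T0" "finite T0" "card T0 = k" "\<And>x. x \<in> T0 \<Longrightarrow> x < m"
          using insert_Max_split[OF T] by blast
        have "T0 \<noteq> {}" using m False by auto
        then have "2 * card (dtrees T) = (\<Sum>A\<in>Pow T0. card (dtrees A) * card (dtrees (T0 - A)))"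
          unfolding m(1) using card_dtrees_insert m by blast
        also have "\<dots> = (\<Sum>A\<in>Pow T0. zigzag (card A) * zigzag (card T0 - card A))"
        proof (rule sum.cong[OF refl])
          fix A assume "A \<in> Pow T0"
          then have A: "A \<subseteq> T0" "finite A" using m(2) finite_subset by auto
          then have "card A < card S" "card (T0 - A) < card S" "card (T0 - A) = card T0 - card A"
            using card_mono[OF m(2) A(1)] card_mono[OF m(2), of "T0 - A"] Suc m(3)
            by (auto simp: card_Diff_subset)
          then show "card (dtrees A) * card (dtrees (T0 - A)) =
              zigzag (card A) * zigzag (card T0 - card A)"
            using less.hyps[of A] less.hyps[of "T0 - A"] A m(2) by simp
        qed
        finally show ?thesis
          using sum_Pow_card[OF m(2), of "\<lambda>j. zigzag j * zigzag (k - j)"] m(3) by simp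
      qed
      have "2 * card (dtrees S) = 2 * zigzag (Suc k)"
        using rec[OF less.prems Suc] rec[of "{1..Suc k}"] by (simp add: zigzag_def)
      then show ?thesis using Suc by simp
    qed
  qed
qed

lemma zigzag_0 [simp]: "zigzag 0 = 1"
  by (simp add: zigzag_def)

lemma zigzag_1 [simp]: "zigzag (Suc 0) = 1"
  by (simp add: zigzag_def dtrees_singleton)

lemma atLeastAtMost_Suc_insert: "{1..Suc n} = insert (Suc n) {1..n}"
  by auto

lemma sum_Pow_card_complement:
  fixes f g :: "nat \<Rightarrow> nat"
  assumes "\<And>A. A \<subseteq> S \<Longrightarrow> F A = f (card A)" "\<And>A. A \<subseteq> S \<Longrightarrow> G A = g (card A)" "finite S"
  shows "(\<Sum>A\<in>Pow S. F A * G (S - A)) = (\<Sum>k\<le>card S. (card S choose k) * (f k * g (card S - k)))"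
proof -
  have "(\<Sum>A\<in>Pow S. F A * G (S - A)) = (\<Sum>A\<in>Pow S. f (card A) * g (card S - card A))"
    using assms by (intro sum.cong) (auto simp: card_Diff_subset finite_subset)
  then show ?thesis using sum_Pow_card[OF assms(3), of "\<lambda>k. f k * g (card S - k)"] by simp
qed

lemma zigzag_rec:
  assumes "n \<ge> 1"
  shows "2 * zigzag (Suc n) = (\<Sum>k\<le>n. (n choose k) * (zigzag k * zigzag (n - k)))"
proof -
  have z: "card (dtrees A) = zigzag (card A)" if "A \<subseteq> {1..n}" for A
    using that finite_subset[OF that] card_dtrees_eq_zigzag by blast
  have "2 * zigzag (Suc n) = (\<Sum>A\<in>Pow {1..n}. card (dtrees A) * card (dtrees ({1..n} - A)))"
    unfolding zigzag_def atLeastAtMost_Suc_insert using assms by (intro card_dtrees_insert) auto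
  then show ?thesis 
    using sum_Pow_card_complement[of "{1..n}" "\<lambda>A. card (dtrees A)" zigzag "\<lambda>A. card (dtrees A)" zigzag] z
    by simp
qed

lemma total_hits_eq_num_hits:
  fixes S :: "nat set"
  assumes "finite S"
  shows "total_hits r S = num_hits r (card S)"
  using assms
proof (induction "card S" arbitrary: S rule: less_induct)
  case less
  show ?case
  proof (cases "card S")
    case 0
    then show ?thesis using less.prems by (simp add: num_hits_def)
  next
    case (Suc k)
    have rec: "total_hits r T = (\<Sum>j\<le>k. (k choose j) * (num_hits r j * zigzag (k - j))) +
        (if k + 1 = r then zigzag (Suc k) else 0)"
      if T: "finite T" "card T = Suc k" for T :: "nat set"
    proof -
      obtain m T0 where m: "T = insert m T0" "finite T0" "card T0 = k" "\<And>x. x \<in> T0 \<Longrightarrow> x < m"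
        using insert_Max_split[OF T] by blast
      have fA: "finite A" if "A \<subseteq> T0" for A using finite_subset[OF that m(2)] .
      have "total_hits r A = num_hits r (card A)" if "A \<subseteq> T0" for A
        using less.hyps[of A] card_mono[OF m(2) that] fA[OF that] Suc m(3) by simp
      moreover have "card (dtrees A) = zigzag (card A)" if "A \<subseteq> T0" for A
        using card_dtrees_eq_zigzag[OF fA[OF that]] .
      ultimately have "(\<Sum>A\<in>Pow T0. total_hits r A * card (dtrees (T0 - A))) =
          (\<Sum>j\<le>k. (k choose j) * (num_hits r j * zigzag (k - j)))"
        using sum_Pow_card_complement[of T0 "total_hits r" "num_hits r" "\<lambda>A. card (dtrees A)" zigzag] m by simp
      moreover have "card (dtrees T) = zigzag (Suc k)"
        using card_dtrees_eq_zigzag[OF T(1)] T(2) by simp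
      ultimately show ?thesis
        using total_hits_insert[OF m(2,4), of r] m by simp
    qed
    show ?thesis
      using rec[OF less.prems Suc] rec[of "{1..Suc k}"] Suc by (simp add: num_hits_def)
  qed
qed

lemma num_hits_0 [simp]: "num_hits r 0 = 0"
  by (simp add: num_hits_def total_hits_def hits_def)

lemma num_hits_rec:
  "num_hits r (Suc n) = (\<Sum>k\<le>n. (n choose k) * (num_hits r k * zigzag (n - k))) +
     (if Suc n = r then zigzag r else 0)"
proof -
  have f: "finite A" if "A \<subseteq> {1..n}" for A using finite_subset[OF that] by simp
  have "(\<Sum>A\<in>Pow {1..n}. total_hits r A * card (dtrees ({1..n} - A))) =
      (\<Sum>k\<le>n. (n choose k) * (num_hits r k * zigzag (n - k)))"
    using sum_Pow_card_complement[of "{1..n}" "total_hits r" "num_hits r" "\<lambda>A. card (dtrees A)" zigzag]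
      total_hits_eq_num_hits card_dtrees_eq_zigzag f by simp
  moreover have "total_hits r (insert (Suc n) {1..n}) =
      (\<Sum>A\<in>Pow {1..n}. total_hits r A * card (dtrees ({1..n} - A))) +
      (if card {1..n} + 1 = r then card (dtrees (insert (Suc n) {1..n})) else 0)"
    by (rule total_hits_insert) auto
  ultimately show ?thesis
    unfolding num_hits_def[of r "Suc n"] atLeastAtMost_Suc_insert
    using zigzag_def[of "Suc n", unfolded atLeastAtMost_Suc_insert] by auto
qed

lemma V_eq:
  assumes "n \<ge> 1"
  shows "V n r = real (num_hits r n) / (real n * real (zigzag n))"
proof -
  let ?P = "tree_vertex_pairs n"
  have P: "?P = dtrees {1..n} \<times> {1..n}"
    using trees12_eq_dtrees[OF assms] by (simp add: tree_vertex_pairs_def)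
  have fin: "finite (dtrees {1..n})" by (simp add: finite_dtrees)
  have "?P \<inter> {(E, v). card (subtree E v) = r} =
      (SIGMA E : dtrees {1..n}. {v \<in> {1..n}. card (subtree E v) = r})"
    unfolding P by auto
  then have "card (?P \<inter> {(E, v). card (subtree E v) = r}) = num_hits r n"
    using fin by (simp add: num_hits_def total_hits_def hits_def)
  moreover have "card ?P = n * zigzag n"
    unfolding P by (simp add: card_cartesian_product zigzag_def)
  ultimately show ?thesis
    unfolding V_def
    using measure_pmf_of_set[OF tree_vertex_pairs_nonempty[OF assms] finite_tree_vertex_pairs] by simp
qed

lemma zigzag_pos: "zigzag n > 0"
proof (cases "n = 0")
  case False
  then have "trees12 n \<noteq> {}"
    using tree_vertex_pairs_nonempty[of n] by (auto simp: tree_vertex_pairs_def)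
  then show ?thesis
    using trees12_eq_dtrees[of n] False finite_dtrees[of "{1..n}"] by (simp add: zigzag_def card_gt_0_iff)
qed simp

section \<open>Generating functions\<close>

text \<open>Polymorphic in the field, since the complex series serve the analysis of the pole and
  the real ones evaluation and integration.\<close>

definition egf :: "(nat \<Rightarrow> nat) \<Rightarrow> 'a::field_char_0 fps" where
  "egf f = Abs_fps (\<lambda>n. of_nat (f n) / fact n)"

lemma egf_nth: "fps_nth (egf f) n = of_nat (f n) / fact n"
  by (simp add: egf_def)

lemma egf_add: "egf f + egf g = egf (\<lambda>n. f n + g n)"
  by (rule fps_ext) (simp add: egf_nth add_divide_distrib)

lemma egf_mult: "egf f * egf g = (egf (\<lambda>n. \<Sum>k\<le>n. (n choose k) * (f k * g (n - k))) :: 'a::field_char_0 fps)"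
proof (rule fps_ext)
  fix n
  have "fps_nth (egf f * egf g :: 'a fps) n =
      (\<Sum>k\<le>n. of_nat (f k) / fact k * (of_nat (g (n - k)) / fact (n - k)))"
    by (simp add: fps_mult_nth egf_nth atLeast0AtMost)
  also have "\<dots> = (\<Sum>k\<le>n. of_nat ((n choose k) * (f k * g (n - k))) / fact n)"
    by (intro sum.cong refl) (simp add: binomial_fact field_simps)
  finally show "fps_nth (egf f * egf g :: 'a fps) n =
      fps_nth (egf (\<lambda>n. \<Sum>k\<le>n. (n choose k) * (f k * g (n - k)))) n"
    by (simp add: egf_nth sum_divide_distrib)
qed

lemma egf_deriv: "fps_deriv (egf f) = (egf (\<lambda>n. f (Suc n)) :: 'a::field_char_0 fps)"
proof (rule fps_ext)
  fix n
  have "(of_nat (Suc n) :: 'a) \<noteq> 0" by (rule of_nat_neq_0)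
  then show "fps_nth (fps_deriv (egf f)) n = fps_nth (egf (\<lambda>n. f (Suc n)) :: 'a fps) n"
    by (simp add: egf_nth divide_simps del: of_nat_Suc)
qed

abbreviation zigzag_fps :: "'a::field_char_0 fps" where "zigzag_fps \<equiv> egf zigzag"

text \<open>At index 0 the recurrence \<open>zigzag_rec\<close> would read 2 = 1; the summand 1
  corrects exactly this coefficient.\<close>

lemma zigzag_fps_ode: "2 * fps_deriv zigzag_fps = 1 + (zigzag_fps * zigzag_fps :: 'a::field_char_0 fps)"
proof (rule fps_ext)
  fix n
  show "fps_nth (2 * fps_deriv zigzag_fps) n = fps_nth (1 + (zigzag_fps * zigzag_fps :: 'a fps)) n"
  proof (cases "n = 0")
    case True
    then show ?thesis by (simp add: egf_nth fps_mult_numeral_left)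
  next
    case False
    have "fps_nth (2 * fps_deriv zigzag_fps :: 'a fps) n = of_nat (2 * zigzag (Suc n)) / fact n"
      unfolding egf_deriv by (simp add: egf_nth fps_mult_numeral_left)
    then show ?thesis
      using False unfolding egf_mult by (subst (asm) zigzag_rec) (simp_all add: egf_nth)
  qed
qed

text \<open>The contribution of the trees in which the chosen vertex is the root.\<close>

definition size_monom :: "nat \<Rightarrow> 'a::field_char_0 fps" where
  "size_monom r = egf (\<lambda>n. if Suc n = r then zigzag r else 0)"

lemma num_hits_ode:
  "fps_deriv (egf (num_hits r)) = (zigzag_fps * egf (num_hits r) + size_monom r :: 'a::field_char_0 fps)"
  by (subst mult.commute) (simp only: size_monom_def egf_deriv egf_mult egf_add num_hits_rec)

text \<open>
  Half angles avoid the common zero of \<open>1 + sin\<close> and \<open>cos\<close> at \<open>-\<pi>/2\<close>: the quotient of the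
  following two series is \<open>sec + tan\<close>, and the square of the second is \<open>1 - sin\<close>.
\<close>

definition trig_plus :: "'a::field_char_0 fps" where "trig_plus = fps_cos (1/2) + fps_sin (1/2)"
definition trig_minus :: "'a::field_char_0 fps" where "trig_minus = fps_cos (1/2) - fps_sin (1/2)"

lemma fps_const_half: "fps_const (1/2 :: 'a::field_char_0) * 2 = 1"
  by (simp add: numeral_fps_const flip: fps_const_mult)

lemma trig_plus_deriv: "2 * fps_deriv trig_plus = (trig_minus :: 'a::field_char_0 fps)"
proof -
  have "2 * fps_deriv trig_plus = fps_const (1/2 :: 'a) * 2 * trig_minus"
    by (simp add: trig_plus_def trig_minus_def fps_sin_deriv fps_cos_deriv algebra_simps flip: fps_const_neg)
  then show ?thesis by (simp only: fps_const_half mult_1)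
qed

lemma trig_minus_deriv: "2 * fps_deriv trig_minus = - (trig_plus :: 'a::field_char_0 fps)"
proof -
  have "2 * fps_deriv trig_minus = - (fps_const (1/2 :: 'a) * 2 * trig_plus)"
    by (simp add: trig_plus_def trig_minus_def fps_sin_deriv fps_cos_deriv algebra_simps flip: fps_const_neg)
  then show ?thesis by (simp only: fps_const_half mult_1)
qed

lemma trig_plus_minus_square: "trig_plus\<^sup>2 + trig_minus\<^sup>2 = (2 :: 'a::field_char_0 fps)"
proof -
  have "trig_plus\<^sup>2 + trig_minus\<^sup>2 = 2 * ((fps_cos (1/2 :: 'a))\<^sup>2 + (fps_sin (1/2))\<^sup>2)"
    by (simp add: trig_plus_def trig_minus_def power2_eq_square algebra_simps)
  then show ?thesis by (simp add: fps_sin_cos_sum_of_squares)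
qed

lemma trig_plus_nth_0: "fps_nth trig_plus 0 = (1 :: 'a::field_char_0)" and trig_minus_nth_0: "fps_nth trig_minus 0 = (1 :: 'a)"
  by (simp_all add: trig_plus_def trig_minus_def fps_cos_def)

text \<open>Comparing coefficients expresses each coefficient of \<open>W\<close> through earlier
  ones, starting from zero.\<close>

lemma fps_homogeneous_ode_zero:
  fixes W :: "'a::field_char_0 fps"
  assumes ode: "fps_deriv W = A * W" and init: "fps_nth W 0 = 0"
  shows "W = 0"
proof -
  have "fps_nth W n = 0" for n
  proof (induction n rule: less_induct)
    case (less n)
    show ?case
    proof (cases n)
      case 0
      then show ?thesis using init by simp
    next
      case (Suc m)
      have "of_nat (Suc m) * fps_nth W (Suc m) = fps_nth (A * W) m"
        unfolding ode[symmetric] by simp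
      also have "\<dots> = 0"
        unfolding fps_mult_nth using less Suc by (intro sum.neutral) auto
      finally show ?thesis using Suc of_nat_neq_0[of m, where ?'a = 'a] by (simp del: of_nat_Suc)
    qed
  qed
  then show ?thesis by (simp add: fps_eq_iff)
qed

lemma trig_minus_mult_zigzag: "trig_minus * zigzag_fps = (trig_plus :: 'a::field_char_0 fps)"
proof -
  let ?W = "trig_minus * zigzag_fps - trig_plus :: 'a fps"
  txt \<open>The Riccati equation for \<open>zigzag_fps\<close> becomes linear in \<open>?W\<close>.\<close>
  have "2 * fps_deriv ?W = (2 * fps_deriv trig_minus) * zigzag_fps + trig_minus * (2 * fps_deriv zigzag_fps) - 2 * fps_deriv trig_plus"
    by (simp add: algebra_simps)
  also have "\<dots> = zigzag_fps * ?W"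
    unfolding trig_minus_deriv trig_plus_deriv zigzag_fps_ode by (simp add: algebra_simps)
  finally have *: "2 * fps_deriv ?W = zigzag_fps * ?W" .
  have "fps_deriv ?W = fps_const (1/2) * 2 * fps_deriv ?W"
    by (simp only: fps_const_half mult_1)
  also have "\<dots> = (fps_const (1/2) * zigzag_fps) * ?W"
    by (simp only: mult.assoc *)
  finally have "?W = 0"
    by (rule fps_homogeneous_ode_zero) (simp add: trig_plus_nth_0 trig_minus_nth_0 egf_nth)
  then show ?thesis by simp
qed

text \<open>The formula \<open>y' = 1 / (1 - sin)\<close> without division: multiply the Riccati
  equation by \<open>trig_minus\<^sup>2\<close> and use that the two squares add up to 2.\<close>

lemma trig_minus_square_mult_deriv: "trig_minus\<^sup>2 * fps_deriv zigzag_fps = (1 :: 'a::field_char_0 fps)"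
proof -
  have "2 * (trig_minus\<^sup>2 * fps_deriv zigzag_fps) = trig_minus\<^sup>2 * (1 + zigzag_fps * zigzag_fps :: 'a fps)"
    by (simp only: zigzag_fps_ode[symmetric] mult_ac)
  also have "\<dots> = trig_minus\<^sup>2 + (trig_minus * zigzag_fps)\<^sup>2"
    by (simp add: power2_eq_square algebra_simps)
  also have "\<dots> = 2 * 1"
    using trig_plus_minus_square by (simp add: trig_minus_mult_zigzag add.commute)
  finally show ?thesis by (metis mult_cancel_left zero_neq_numeral)
qed

text \<open>The series \<open>G\<^sub>r\<close>. As \<open>y'\<close> solves the homogeneous part of
  \<open>num_hits_ode\<close>, its inverse \<open>trig_minus\<^sup>2\<close> is an integrating
  factor, and the unknown series drops out of the derivative.\<close>

definition hits_kernel :: "nat \<Rightarrow> 'a::field_char_0 fps" where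
  "hits_kernel r = trig_minus\<^sup>2 * egf (num_hits r)"

lemma hits_kernel_deriv: "fps_deriv (hits_kernel r) = (trig_minus\<^sup>2 * size_monom r :: 'a::field_char_0 fps)"
proof -
  have "fps_deriv (hits_kernel r) = (2 * fps_deriv trig_minus) * trig_minus * egf (num_hits r) +
      trig_minus\<^sup>2 * (zigzag_fps * egf (num_hits r) + size_monom r :: 'a fps)"
    unfolding hits_kernel_def num_hits_ode[symmetric] by (simp add: power2_eq_square algebra_simps)
  also have "\<dots> = trig_minus * egf (num_hits r) * (trig_minus * zigzag_fps - trig_plus) + trig_minus\<^sup>2 * size_monom r"
    unfolding trig_minus_deriv by (simp add: power2_eq_square algebra_simps)
  finally show ?thesis by (simp add: trig_minus_mult_zigzag)
qed

lemma hits_kernel_nth_0: "fps_nth (hits_kernel r) 0 = 0"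
  by (simp add: hits_kernel_def egf_nth)

lemma egf_num_hits: "egf (num_hits r) = (hits_kernel r * fps_deriv zigzag_fps :: 'a::field_char_0 fps)"
  using trig_minus_square_mult_deriv[where ?'a = 'a] by (simp add: hits_kernel_def mult_ac)

text \<open>The constant is also the coefficient of index \<open>r\<close> in \<open>y'\<close>, so
  summing over all sizes rebuilds \<open>y'\<close>.\<close>

lemma size_monom_eq: "size_monom (Suc r) = (fps_const (of_nat (zigzag (Suc r)) / fact r) * fps_X ^ r :: 'a::field_char_0 fps)"
  by (rule fps_ext) (simp add: size_monom_def egf_nth)

lemma zigzag_fps_deriv_nth: "fps_nth (fps_deriv zigzag_fps) n = (of_nat (zigzag (Suc n)) / fact n :: 'a::field_char_0)"
  by (simp add: egf_deriv egf_nth)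

section \<open>Asymptotics of the coefficients\<close>

lemma has_fps_expansion_trig_plus: "(\<lambda>z::complex. cos (z / 2) + sin (z / 2)) has_fps_expansion trig_plus"
  using has_fps_expansion_add[OF has_fps_expansion_cos[of "1/2"] has_fps_expansion_sin[of "1/2"]]
  by (simp add: trig_plus_def)

lemma has_fps_expansion_trig_minus: "(\<lambda>z::complex. cos (z / 2) - sin (z / 2)) has_fps_expansion trig_minus"
  using has_fps_expansion_diff[OF has_fps_expansion_cos[of "1/2"] has_fps_expansion_sin[of "1/2"]]
  by (simp add: trig_minus_def)

lemma has_fps_expansion_zigzag:
  "(\<lambda>z::complex. (cos (z / 2) + sin (z / 2)) / (cos (z / 2) - sin (z / 2))) has_fps_expansion zigzag_fps"
proof -
  have "trig_plus / trig_minus = (zigzag_fps :: complex fps)"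
    using trig_minus_mult_zigzag[where ?'a = complex] trig_minus_nth_0[where ?'a = complex]
    by (metis fps_nonzero_nth nonzero_mult_div_cancel_left zero_neq_one)
  then show ?thesis
    using has_fps_expansion_divide'[OF has_fps_expansion_trig_plus has_fps_expansion_trig_minus] trig_minus_nth_0[where ?'a = complex] by simp
qed

text \<open>The difference is a nonzero multiple of \<open>sin ((pi/2 - z) / 2)\<close>, so its
  zeros are \<open>pi/2 - 2 * n * pi\<close>. The second smallest in modulus,
  \<open>-3 * pi / 2\<close>, lies just on the boundary of the disc.\<close>

lemma cos_minus_sin_half_eq_0:
  fixes z :: complex
  assumes "cos (z / 2) - sin (z / 2) = 0" "norm z < 3 * pi / 2"
  shows "z = of_real pi / 2"
proof -
  have "cos (z / 2) - sin (z / 2) = sin (of_real pi / 2 - z / 2) - sin (z / 2)"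
    by (simp add: sin_diff)
  also have "\<dots> = 2 * sin ((of_real pi / 2 - z) / 2) * cos (of_real pi / 4)"
  proof -
    have "(of_real pi / 2 - z / 2 - z / 2) / 2 = (of_real pi / 2 - z) / 2"
      "(of_real pi / 2 - z / 2 + z / 2) / 2 = of_real pi / 4"
      by (simp_all add: field_simps)
    then show ?thesis by (simp only: sin_diff_sin)
  qed
  finally have "sin ((of_real pi / 2 - z) / 2) * cos (of_real (pi / 4)) = 0"
    using assms(1) by simp
  moreover have "cos (of_real (pi / 4) :: complex) \<noteq> 0"
    unfolding cos_of_real by (simp add: cos_45)
  ultimately have "sin ((of_real pi / 2 - z) / 2) = 0" by simp
  then obtain n :: int where n: "(of_real pi / 2 - z) / 2 = of_real (n * pi)"
    unfolding sin_eq_0 by blast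
  then have z: "z = of_real (pi / 2 - 2 * n * pi)" by (simp add: field_simps)
  have "\<bar>pi / 2 - 2 * n * pi\<bar> < 3 * pi / 2"
    using assms(2) unfolding z norm_of_real .
  then have "\<bar>(1/2 - 2 * n) * pi\<bar> < 3/2 * pi" by (simp add: algebra_simps)
  then have "\<bar>1/2 - 2 * real_of_int n\<bar> < 3/2" by (simp add: abs_mult)
  then have "n = 0" by linarith
  then show ?thesis using z by simp
qed

text \<open>The linear factor cancels the simple pole, so the product is holomorphic up to radius
  \<open>3 * pi / 2\<close> and its Taylor series converges at \<open>pi/2\<close>. The value is
  \<open>- P / Q'\<close> there, which is 2 because \<open>Q' = - P / 2\<close>.\<close>

lemma zigzag_fps_mult_linear_sums:
  "(\<lambda>n. fps_nth ((fps_const (of_real (pi/2)) - fps_X) * zigzag_fps :: complex fps) n * of_real (pi/2) ^ n) sums 2"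
proof -
  define \<rho> :: complex where "\<rho> = of_real (pi / 2)"
  define P Q :: "complex \<Rightarrow> complex" where "P = (\<lambda>z. cos (z / 2) + sin (z / 2))"
    and "Q = (\<lambda>z. cos (z / 2) - sin (z / 2))"
  \<comment> \<open>The difference quotient of \<open>Q\<close> with its removable singularity
    filled in: \<open>Q z = (z - \<rho>) * g z\<close>, and \<open>g\<close> has no zero in the
    disc.\<close>
  define g where "g = (\<lambda>z. if z = \<rho> then deriv Q \<rho> else (Q z - Q \<rho>) / (z - \<rho>))"
  let ?B = "ball 0 (3 * pi / 2) :: complex set"
  have \<rho>2: "\<rho> / 2 = of_real (pi / 4)" by (simp add: \<rho>_def)
  have val: "Q \<rho> = 0" "P \<rho> = of_real (sqrt 2)"
    unfolding P_def Q_def \<rho>2 cos_of_real sin_of_real by (simp_all add: cos_45 sin_45)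
  have dQ: "(Q has_field_derivative - P z / 2) (at z)" for z
    unfolding P_def Q_def by (auto intro!: derivative_eq_intros simp: field_simps)
  then have deriv: "deriv Q \<rho> = - P \<rho> / 2" by (simp add: DERIV_imp_deriv)
  have holQ: "Q holomorphic_on ?B" "P holomorphic_on ?B"
    unfolding P_def Q_def by (intro holomorphic_intros; simp)+
  have holg: "g holomorphic_on ?B"
    unfolding g_def by (rule pole_lemma_open[OF holQ(1)]) simp
  have nz: "g z \<noteq> 0" if "z \<in> ?B" for z
  proof (cases "z = \<rho>")
    case True
    then show ?thesis using val by (simp add: g_def deriv)
  next
    case False
    then have "Q z \<noteq> 0"
      using cos_minus_sin_half_eq_0[of z] that by (auto simp: Q_def \<rho>_def)
    then show ?thesis using False val by (simp add: g_def)
  qed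
  have holh: "(\<lambda>z. - P z / g z) holomorphic_on ?B"
    using holg holQ nz by (intro holomorphic_intros) auto
  have e1: "(\<lambda>z. (\<rho> - z) * (P z / Q z)) has_fps_expansion (fps_const \<rho> - fps_X) * zigzag_fps"
    unfolding P_def Q_def by (intro fps_expansion_intros has_fps_expansion_zigzag)
  have e2: "eventually (\<lambda>z. (\<rho> - z) * (P z / Q z) = - P z / g z) (nhds 0)"
  proof -
    have "\<rho> \<noteq> 0" by (simp add: \<rho>_def)
    then have "eventually (\<lambda>z. z \<noteq> \<rho>) (nhds 0)" by (intro t1_space_nhds) auto
    then show ?thesis
      by eventually_elim (auto simp: g_def val divide_simps algebra_simps)
  qed
  have exp: "(\<lambda>z. - P z / g z) has_fps_expansion (fps_const \<rho> - fps_X) * zigzag_fps"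
    by (rule has_fps_expansion_cong[OF e2 refl, THEN iffD1, OF e1])
  have "(\<lambda>n. fps_nth ((fps_const \<rho> - fps_X) * zigzag_fps) n * \<rho> ^ n) sums (- P \<rho> / g \<rho>)"
    by (rule has_fps_expansion_imp_sums_complex[OF exp, of "3 * pi / 2"])
      (use holh in \<open>auto simp: \<rho>_def\<close>)
  moreover have "- P \<rho> / g \<rho> = 2" using val by (simp add: g_def deriv)
  ultimately show ?thesis by (simp add: \<rho>_def)
qed

lemma zigzag_asymptotics:
  "(\<lambda>n. real (zigzag n) / fact n * (pi/2) ^ Suc n) \<longlonglongrightarrow> 2"
proof -
  let ?b = "\<lambda>n. real (zigzag n) / fact n"
  let ?H = "\<lambda>n. fps_nth ((fps_const (of_real (pi/2)) - fps_X) * zigzag_fps :: complex fps) n * of_real (pi/2) ^ n"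
  have H: "?H n = of_real (pi/2 * ?b n - (if n = 0 then 0 else ?b (n - 1))) * of_real (pi/2) ^ n" for n
    by (simp add: algebra_simps egf_nth)
  txt \<open>The partial sums at \<open>\<pi>/2\<close> telescope.\<close>
  have "(\<Sum>k\<le>n. ?H k) = of_real (?b n * (pi/2) ^ Suc n)" for n
  proof (induction n)
    case 0
    then show ?case unfolding H by simp
  next
    case (Suc n)
    have "(\<Sum>k\<le>Suc n. ?H k) = of_real (?b n * (pi/2) ^ Suc n) + ?H (Suc n)"
      using Suc by simp
    then show ?case unfolding H by (simp add: algebra_simps)
  qed
  then have "(\<lambda>n. complex_of_real (?b n * (pi/2) ^ Suc n)) \<longlonglongrightarrow> of_real 2"
    using zigzag_fps_mult_linear_sums unfolding sums_def_le by simp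
  then show ?thesis unfolding tendsto_of_real_iff .
qed

lemma zigzag_fps_deriv_ratio:
  defines "c \<equiv> fps_nth (fps_deriv zigzag_fps :: real fps)"
  shows "(\<lambda>n. c n / c (Suc n)) \<longlonglongrightarrow> pi / 2"
proof -
  let ?d = "\<lambda>n. real (zigzag n) / fact n * (pi/2) ^ Suc n"
  have lim: "(\<lambda>n. ?d (n + k)) \<longlonglongrightarrow> 2" for k
    using zigzag_asymptotics by (rule LIMSEQ_ignore_initial_segment)
  \<comment> \<open>Differentiation shifts the index and multiplies by it, whence
    \<open>n + 1\<close>, \<open>n + 2\<close> and their quotient; the last factor
    \<open>pi / 2\<close> restores the power lost in the quotient of the \<open>?d\<close>.\<close>
  have "(\<lambda>n. ?d (n + 1) / ?d (n + 2) * (real (n + 1) / real (n + 2)) * (pi / 2)) \<longlonglongrightarrow> 2 / 2 * 1 * (pi / 2)"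
  proof -
    have "(\<lambda>n. real (n + 1) / real (n + 2)) \<longlonglongrightarrow> 1" by real_asymp
    then show ?thesis by (intro tendsto_intros lim) simp_all
  qed
  moreover have "?d (n + 1) / ?d (n + 2) * (real (n + 1) / real (n + 2)) * (pi / 2) = c n / c (Suc n)" for n
  proof -
    have alg: "x / ((m + 1) * F) * (H * h) / (y / ((m + 2) * ((m + 1) * F)) * (H * h * h)) *
        ((m + 1) / (m + 2)) * h = (x / F) / (y / ((m + 1) * F))"
      if "y > 0" "F > 0" "H > 0" "h > 0" "m \<ge> 0" for x y F H h m :: real
      using that by (simp add: divide_simps)
    show ?thesis
      using alg[of "real (zigzag (Suc (Suc n)))" "fact n" "(pi/2) ^ Suc n" "pi/2" "real n"
          "real (zigzag (Suc n))"] zigzag_pos[of "Suc (Suc n)"]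
      unfolding c_def zigzag_fps_deriv_nth by (simp add: mult_ac add_ac)
  qed
  ultimately show ?thesis by simp
qed

lemma zigzag_fps_deriv_nth_pos: "fps_nth (fps_deriv zigzag_fps :: real fps) n > 0"
  unfolding zigzag_fps_deriv_nth using zigzag_pos by simp

lemma fps_conv_radius_zigzag_deriv: "fps_conv_radius (fps_deriv zigzag_fps :: real fps) = ereal (pi / 2)"
  unfolding fps_conv_radius_def
  by (rule conv_radius_ratio_limit_nonzero[OF refl])
    (use zigzag_fps_deriv_ratio zigzag_fps_deriv_nth_pos in \<open>simp_all add: abs_of_pos del: fps_deriv_nth\<close>)

section \<open>The limits and their sum\<close>

text \<open>Up to a shift, the coefficients of \<open>f\<close> are bounded in norm by those of its
  derivative, so the series of the derivative dominates.\<close>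

lemma fps_conv_radius_integral_infinite:
  fixes f :: "'a::{banach, real_normed_field} fps"
  assumes "fps_conv_radius (fps_deriv f) = \<infinity>"
  shows "fps_conv_radius f = \<infinity>"
proof -
  have "fps_conv_radius (fps_shift 1 f) = \<infinity>"
    unfolding fps_conv_radius_def
  proof (rule conv_radius_inftyI'')
    fix z :: 'a
    have "summable (\<lambda>n. norm (fps_nth (fps_deriv f) n * z ^ n))"
      by (rule norm_summable_fps) (simp add: assms)
    then show "summable (\<lambda>n. fps_nth (fps_shift 1 f) n * z ^ n)"
    proof (rule summable_comparison_test'[where N = 0])
      fix n
      have "1 * norm (fps_nth f (Suc n)) \<le> norm (of_nat (Suc n) :: 'a) * norm (fps_nth f (Suc n))"
        by (intro mult_right_mono) (simp_all del: of_nat_Suc)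
      then show "norm (fps_nth (fps_shift 1 f) n * z ^ n) \<le> norm (fps_nth (fps_deriv f) n * z ^ n)"
        by (simp add: norm_mult mult_right_mono del: of_nat_Suc)
    qed
  qed
  then show ?thesis by simp
qed

lemma fps_conv_radius_trig_minus [simp]: "fps_conv_radius (trig_minus :: real fps) = \<infinity>"
  using fps_conv_radius_diff[of "fps_cos (1/2 :: real)" "fps_sin (1/2)"] by (simp add: trig_minus_def)

lemma fps_conv_radius_size_monom [simp]: "fps_conv_radius (size_monom (Suc r) :: real fps) = \<infinity>"
  using fps_conv_radius_mult[of "fps_const (real (zigzag (Suc r)) / fact r)" "fps_X ^ r"]
  by (simp add: size_monom_eq)

lemma fps_conv_radius_trig_minus_square [simp]: "fps_conv_radius (trig_minus\<^sup>2 :: real fps) = \<infinity>"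
  using fps_conv_radius_power[of "trig_minus :: real fps" 2] by simp

lemma fps_conv_radius_hits_kernel [simp]: "fps_conv_radius (hits_kernel (Suc r) :: real fps) = \<infinity>"
  by (rule fps_conv_radius_integral_infinite)
    (use fps_conv_radius_mult[of "trig_minus\<^sup>2" "size_monom (Suc r) :: real fps"] in \<open>simp add: hits_kernel_deriv\<close>)

text \<open>This is \<open>1 - sin t\<close>; the square form makes nonnegativity and the zero at
  \<open>pi/2\<close> immediate.\<close>

lemma eval_trig_minus_square: "eval_fps (trig_minus\<^sup>2) t = (cos (t / 2) - sin (t / 2))\<^sup>2" for t :: real
proof -
  have "eval_fps trig_minus t = cos (t / 2) - sin (t / 2)" by (simp add: trig_minus_def eval_fps_diff)
  then show ?thesis by (simp add: power2_eq_square eval_fps_mult)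
qed

lemma eval_hits_kernel_deriv:
  fixes t :: real
  shows "eval_fps (fps_deriv (hits_kernel (Suc r))) t = eval_fps (trig_minus\<^sup>2) t * (fps_nth (fps_deriv zigzag_fps) r * t ^ r)"
proof -
  have "eval_fps (size_monom (Suc r)) t = fps_nth (fps_deriv zigzag_fps) r * t ^ r"
    unfolding size_monom_eq zigzag_fps_deriv_nth by (subst eval_fps_mult) simp_all
  then show ?thesis unfolding hits_kernel_deriv by (subst eval_fps_mult) simp_all
qed

text \<open>\<open>V (Suc n) (Suc r)\<close> is a convolution of the coefficients of
  \<open>G\<^sub>r\<close> with the quotients \<open>c (n - k) / c n\<close>, which tend to
  \<open>(pi / 2) ^ k\<close> and are at most \<open>K ^ k\<close>. Tannery's theorem exchanges
  limit and sum.\<close>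

lemma V_tendsto: "(\<lambda>n. V n (Suc r)) \<longlonglongrightarrow> eval_fps (hits_kernel (Suc r)) (pi / 2) / (pi / 2)"
proof -
  define c where "c = fps_nth (fps_deriv zigzag_fps :: real fps)"
  define \<gamma> where "\<gamma> = fps_nth (hits_kernel (Suc r) :: real fps)"
  have cpos: "c n > 0" for n unfolding c_def by (rule zigzag_fps_deriv_nth_pos)
  have ratio: "(\<lambda>n. c n / c (Suc n)) \<longlonglongrightarrow> pi / 2"
    unfolding c_def by (rule zigzag_fps_deriv_ratio)
  obtain K where K: "K > 0" "\<And>n. norm (c n / c (Suc n)) \<le> K"
    using convergent_imp_Bseq[OF convergentI[OF ratio]] by (auto simp: Bseq_def)
  have ratio_le: "c n / c (Suc n) \<le> K" for n
    using K(2)[of n] unfolding real_norm_def by (rule abs_le_D1)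
  have V: "V (Suc n) (Suc r) = (\<Sum>k\<le>n. \<gamma> (Suc k) * (c (n - k) / c n))" for n
  proof -
    have "V (Suc n) (Suc r) = fps_nth (egf (num_hits (Suc r))) (Suc n) / c n"
      unfolding c_def zigzag_fps_deriv_nth by (simp add: V_eq egf_nth)
    also have "fps_nth (egf (num_hits (Suc r)) :: real fps) (Suc n) = (\<Sum>k\<le>Suc n. \<gamma> k * c (Suc n - k))"
      unfolding egf_num_hits fps_mult_nth by (simp add: \<gamma>_def c_def atLeast0AtMost)
    also have "\<dots> = (\<Sum>k\<le>n. \<gamma> (Suc k) * c (n - k))"
      by (subst sum.atMost_Suc_shift) (simp add: \<gamma>_def hits_kernel_nth_0)
    finally show ?thesis by (simp add: sum_divide_distrib)
  qed
  \<comment> \<open>Padding with zeros turns the sums of growing length into series over a fixed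
    index set.\<close>
  define a where "a = (\<lambda>k n. if k \<le> n then \<gamma> (Suc k) * (c (n - k) / c n) else 0)"
  have quot: "(\<lambda>n. c n / c (n + k)) \<longlonglongrightarrow> (pi / 2) ^ k \<and> (\<forall>n. c n / c (n + k) \<le> K ^ k)" for k
  proof (induction k)
    case 0
    then show ?case using cpos by (simp add: less_imp_neq[THEN not_sym])
  next
    case (Suc k)
    have eq: "c n / c (n + Suc k) = c n / c (n + k) * (c (n + k) / c (Suc (n + k)))" for n
      using cpos[of "n + k"] by simp
    have "(\<lambda>n. c n / c (n + Suc k)) \<longlonglongrightarrow> (pi / 2) ^ k * (pi / 2)"
      unfolding eq using Suc LIMSEQ_ignore_initial_segment[OF ratio, of k]
      by (intro tendsto_mult) simp_all
    moreover have "c n / c (n + Suc k) \<le> K ^ k * K" for n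
      unfolding eq
    proof (rule mult_mono)
      show "c n / c (n + k) \<le> K ^ k" using Suc by blast
      show "c (n + k) / c (Suc (n + k)) \<le> K" by (rule ratio_le)
      show "0 \<le> K ^ k" using K(1) by simp
      show "0 \<le> c (n + k) / c (Suc (n + k))" using cpos by (simp add: less_imp_le)
    qed
    ultimately show ?case by (simp add: mult.commute)
  qed
  have "(\<lambda>n. \<Sum>k. a k n) \<longlonglongrightarrow> (\<Sum>k. \<gamma> (Suc k) * (pi / 2) ^ k)"
  proof (rule tannerys_theorem[where M = "\<lambda>k. norm (\<gamma> (Suc k)) * K ^ k", THEN conjunct2, THEN conjunct2])
    fix k
    \<comment> \<open>Shifting \<open>n\<close> by \<open>k\<close> replaces
      \<open>c (n - k) / c n\<close> by \<open>c n / c (n + k)\<close> and avoids truncated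
      subtraction.\<close>
    have "(\<lambda>n. \<gamma> (Suc k) * (c n / c (n + k))) \<longlonglongrightarrow> \<gamma> (Suc k) * (pi / 2) ^ k"
      using quot by (intro tendsto_intros) simp
    then have "(\<lambda>n. a k (n + k)) \<longlonglongrightarrow> \<gamma> (Suc k) * (pi / 2) ^ k"
      by (simp add: a_def)
    then show "a k \<longlonglongrightarrow> \<gamma> (Suc k) * (pi / 2) ^ k"
      by (rule LIMSEQ_offset)
  next
    have "norm (a k n) \<le> norm (\<gamma> (Suc k)) * K ^ k" for k n
    proof (cases "k \<le> n")
      case True
      then have "c (n - k) / c n \<le> K ^ k" using quot[of k] by (metis le_add_diff_inverse2)
      then have "norm (\<gamma> (Suc k)) * (c (n - k) / c n) \<le> norm (\<gamma> (Suc k)) * K ^ k"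
        by (rule mult_left_mono) simp
      then show ?thesis using True cpos[of n] cpos[of "n - k"]
        by (simp add: a_def abs_mult)
    qed (use K in \<open>simp add: a_def\<close>)
    then show "eventually (\<lambda>(k, n). norm (a k n) \<le> norm (\<gamma> (Suc k)) * K ^ k) (at_top \<times>\<^sub>F at_top)"
      by (intro always_eventually) auto
    \<comment> \<open>The bound \<open>K\<close> may exceed \<open>pi / 2\<close>; summability holds
      for every \<open>K\<close> because \<open>hits_kernel\<close> is entire.\<close>
    have "summable (\<lambda>n. norm (fps_nth (fps_shift 1 (hits_kernel (Suc r)) :: real fps) n * K ^ n))"
      by (rule norm_summable_fps) simp
    then show "summable (\<lambda>k. norm (\<gamma> (Suc k)) * K ^ k)"
      using K by (simp add: \<gamma>_def abs_mult)
  qed simp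
  moreover have "(\<Sum>k. a k n) = V (Suc n) (Suc r)" for n
  proof -
    have "(\<Sum>k. a k n) = (\<Sum>k\<le>n. a k n)" by (rule suminf_finite) (auto simp: a_def)
    then show ?thesis by (simp add: V a_def)
  qed
  \<comment> \<open>The constant coefficient is zero, so the index shift amounts to dividing by
    \<open>pi / 2\<close>.\<close>
  moreover have "(\<Sum>k. \<gamma> (Suc k) * (pi / 2) ^ k) = eval_fps (hits_kernel (Suc r)) (pi / 2) / (pi / 2)"
  proof -
    have "(\<lambda>k. \<gamma> k * (pi / 2) ^ k) sums eval_fps (hits_kernel (Suc r)) (pi / 2)"
      unfolding \<gamma>_def by (rule sums_eval_fps) simp
    then have "(\<lambda>k. \<gamma> (Suc k) * (pi / 2) ^ Suc k) sums eval_fps (hits_kernel (Suc r)) (pi / 2)"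
      by (subst sums_Suc_iff) (simp add: \<gamma>_def hits_kernel_nth_0)
    then have "(\<lambda>k. \<gamma> (Suc k) * (pi / 2) ^ Suc k / (pi / 2)) sums
        (eval_fps (hits_kernel (Suc r)) (pi / 2) / (pi / 2))"
      by (rule sums_divide)
    then show ?thesis by (simp add: sums_iff)
  qed
  ultimately have "(\<lambda>n. V (Suc n) (Suc r)) \<longlonglongrightarrow> eval_fps (hits_kernel (Suc r)) (pi / 2) / (pi / 2)"
    by simp
  then show ?thesis by (rule LIMSEQ_imp_Suc)
qed

lemma eval_hits_kernel_has_integral:
  "((\<lambda>t. eval_fps (trig_minus\<^sup>2) t * (fps_nth (fps_deriv zigzag_fps) r * t ^ r)) has_integral
     eval_fps (hits_kernel (Suc r)) (pi / 2)) {0..pi / 2}"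
proof -
  have "((\<lambda>t. eval_fps (fps_deriv (hits_kernel (Suc r))) t) has_integral
      (eval_fps (hits_kernel (Suc r)) (pi / 2) - eval_fps (hits_kernel (Suc r)) 0)) {0..pi / 2}"
    by (rule fundamental_theorem_of_calculus)
      (simp_all add: has_field_derivative_eval_fps flip: has_real_derivative_iff_has_vector_derivative)
  then show ?thesis by (simp add: eval_hits_kernel_deriv eval_fps_at_0 hits_kernel_nth_0)
qed

text \<open>By \<open>eval_hits_kernel_has_integral\<close> the terms are integrals of nonnegative
  functions whose sum is \<open>(1 - sin t) * y' t = 1\<close> before \<open>pi/2\<close>; dominated
  convergence exchanges sum and integral.\<close>

lemma eval_hits_kernel_sums: "(\<lambda>r. eval_fps (hits_kernel (Suc r)) (pi / 2)) sums (pi / 2)"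
proof -
  let ?S = "{0..pi / 2}"
  define f where "f = (\<lambda>r t. eval_fps (trig_minus\<^sup>2) t * (fps_nth (fps_deriv zigzag_fps) r * t ^ r) :: real)"
  \<comment> \<open>The pointwise sum. At \<open>pi/2\<close> the series of \<open>y'\<close> is
    beyond its disc of convergence, but the factor \<open>1 - sin t\<close> makes every term
    zero.\<close>
  define g where "g = (\<lambda>t. if t = pi / 2 then 0 else 1 :: real)"
  have int: "((\<lambda>t. \<Sum>r<n. f r t) has_integral (\<Sum>r<n. eval_fps (hits_kernel (Suc r)) (pi / 2))) ?S" for n
    unfolding f_def by (intro has_integral_sum eval_hits_kernel_has_integral) simp
  have f_nonneg: "f r t \<ge> 0" if "t \<in> ?S" for r t
    using that less_imp_le[OF zigzag_fps_deriv_nth_pos] unfolding f_def eval_trig_minus_square by simp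
  have sums: "(\<lambda>r. f r t) sums g t" if t: "t \<in> ?S" for t
  proof (cases "t = pi / 2")
    case True
    have "cos (t / 2) = sin (t / 2)" by (simp add: True cos_45 sin_45)
    then have "eval_fps (trig_minus\<^sup>2) t = 0" by (simp add: eval_trig_minus_square)
    then show ?thesis by (simp add: f_def g_def True)
  next
    case False
    have n: "ereal (norm t) < fps_conv_radius (fps_deriv zigzag_fps :: real fps)"
      using t False by (simp add: fps_conv_radius_zigzag_deriv)
    have "(\<lambda>r. f r t) sums (eval_fps (trig_minus\<^sup>2) t * eval_fps (fps_deriv zigzag_fps) t)"
      unfolding f_def by (intro sums_mult sums_eval_fps n)
    also have "eval_fps (trig_minus\<^sup>2) t * eval_fps (fps_deriv zigzag_fps) t = eval_fps (trig_minus\<^sup>2 * fps_deriv zigzag_fps) t"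
      using n by (intro eval_fps_mult[symmetric]) simp_all
    finally show ?thesis using False by (simp add: trig_minus_square_mult_deriv g_def)
  qed
  \<comment> \<open>Since the terms are nonnegative, the partial sums lie between 0 and
    \<open>g\<close>, so the constant 1 dominates.\<close>
  have "(\<lambda>n. integral ?S (\<lambda>t. \<Sum>r<n. f r t)) \<longlonglongrightarrow> integral ?S g"
  proof (rule dominated_convergence(2)[where h = "\<lambda>_. 1"])
    fix n t assume t: "t \<in> ?S"
    have "(\<Sum>r<n. f r t) \<le> g t"
      using sum_le_suminf[OF sums_summable[OF sums[OF t]], of "{..<n}"] f_nonneg[OF t] sums[OF t]
      by (simp add: sums_iff)
    moreover have "0 \<le> (\<Sum>r<n. f r t)" using f_nonneg[OF t] by (intro sum_nonneg) simp
    ultimately show "norm (\<Sum>r<n. f r t) \<le> 1" by (simp add: g_def split: if_splits)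
  qed (use int sums in \<open>auto simp: sums_def\<close>)
  also have "integral ?S g = integral ?S (\<lambda>_. 1)"
    by (rule integral_spike[of "{pi / 2}"]) (auto simp: g_def)
  finally show ?thesis
    using int[THEN integral_unique] by (simp add: sums_def)
qed

theorem theorem2p9:
  shows "(\<forall>r\<ge>1. convergent (\<lambda>n. V n r)) \<and> (\<lambda>r. v_lim (Suc r)) sums 1"
proof
  show "\<forall>r\<ge>1. convergent (\<lambda>n. V n r)"
    using V_tendsto by (metis Suc_le_D One_nat_def convergentI)
  have "v_lim (Suc r) = eval_fps (hits_kernel (Suc r)) (pi / 2) / (pi / 2)" for r
    unfolding v_lim_def by (rule limI[OF V_tendsto])
  then show "(\<lambda>r. v_lim (Suc r)) sums 1"
    using sums_divide[OF eval_hits_kernel_sums, of "pi / 2"] by simp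
qed

end
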